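(* Let $K$ and $L$ be compact Hausdorff spaces and let $T: C(K)\to C(L)$ be a positive isomorphic embedding such that $T1_K=1_L$ and $\|T^{-1}\|=1/m$. For $y\in L$ let $\nu_y=T^*\delta_y\in M(K)$, and for $r\in(0,1]$ and $y\in L$ put \[ \varphi_r(y)=\{x\in K: \nu_y(\{x\})\ge r\}.\] Then for every $r\in (0,1]$: (i) $\varphi_r$ takes its values in $[K]^{\le p}$, where $p$ is the integer part of $1/r$, and $\varphi_r$ is upper semicontinuous; (ii) the set $\bigcup_{y\in L}\varphi_r(y)$ is closed in $K$. Moreover, (iii) the mapping $\varphi_m$ is onto $K$, i.e. $\bigcup_{y\in L}\varphi_m(y)=K$.
   Context: $C(K)$ is the Banach space of real-valued continuous functions on $K$ with the supremum norm. An isomorphic embedding $T:C(K)\to C(L)$ is a linear operator (not necessarily surjective) for which there are constants $m_1,m_2>0$ with $m_1\|g\|\le\|Tg\|\le m_2\|g\|$ for all $g\in C(K)$; $\|T^{-1}\|$ is the norm of the inverse operator $T^{-1}:T[C(K)]\to C(K)$ defined on the range of $T$. $T$ is positive if $g\ge 0$ implies $Tg\ge 0$. $1_K$, $1_L$ are the constant functions equal to $1$. $M(K)=C(K)^*$ is the space of signed Radon measures of finite variation on $K$, $\delta_y$ is the Dirac measure at $y$, and $T^*:M(L)\to M(K)$ is the conjugate operator, so $\nu_y(g)=\int_K g\,d\nu_y=Tg(y)$ for $g\in C(K)$. $[K]^{\le p}$ is the family of all subsets of $K$ with at most $p$ elements (including the empty set). A set-valued mapping $\varphi:L\to[K]^{\le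 p}$ is upper semicontinuous if $\{y\in L:\varphi(y)\subseteq U\}$ is open in $L$ for every open $U\subseteq K$. *)

theory Defs
  imports "HOL-Probability.Probability"
begin

text \<open>
  For a compact space \<open>K\<close> every continuous real function is bounded, so \<open>C(K)\<close> with the supremum
  norm is the library type of bounded continuous functions \<open>'k \<Rightarrow>\<^sub>C real\<close>.
\<close>

definition isomorphic_embedding ::
  "('a::real_normed_vector \<Rightarrow> 'b::real_normed_vector) \<Rightarrow> bool" where
  "isomorphic_embedding T \<longleftrightarrow> linear T \<and>
     (\<exists>m1>0. \<exists>m2>0. \<forall>g. m1 * norm g \<le> norm (T g) \<and> norm (T g) \<le> m2 * norm g)"

definition positive_operator ::
  "(('k::topological_space \<Rightarrow>\<^sub>C real) \<Rightarrow> ('l::topological_space \<Rightarrow>\<^sub>C real)) \<Rightarrow> bool" where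
  "positive_operator T \<longleftrightarrow>
     (\<forall>g. (\<forall>x. 0 \<le> apply_bcontfun g x) \<longrightarrow> (\<forall>y. 0 \<le> apply_bcontfun (T g) y))"

text \<open>
  Operator norm of a map defined only on the subspace \<open>S\<close>, following the library's
  \<^const>\<open>onorm\<close>; the zero vector contributes \<open>0 / 0 = 0\<close>.
\<close>

definition onorm_on ::
  "'a::real_normed_vector set \<Rightarrow> ('a \<Rightarrow> 'b::real_normed_vector) \<Rightarrow> real" where
  "onorm_on S f = (SUP x\<in>S. norm (f x) / norm x)"

definition inverse_norm ::
  "('a::real_normed_vector \<Rightarrow> 'b::real_normed_vector) \<Rightarrow> real" where
  "inverse_norm T = onorm_on (range T) (inv T)"


definition finite_radon_measure :: "'a::t2_space measure \<Rightarrow> bool" where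
  "finite_radon_measure M \<longleftrightarrow> sets M = sets borel \<and> finite_measure M \<and>
     (\<forall>B\<in>sets borel. emeasure M B = (SUP C\<in>{C. C \<subseteq> B \<and> compact C}. emeasure M C))"

text \<open>
  The space \<open>M(K)\<close> of signed Radon measures of finite variation: by the Jordan decomposition these
  are the differences of two finite Radon measures. They are represented as real-valued
  set functions, with value \<open>0\<close> on non-Borel sets (since \<^const>\<open>measure\<close> is \<open>0\<close> there), so that
  two of them are equal iff they agree on the Borel sets.
\<close>

definition signed_radon_measures :: "('a::t2_space set \<Rightarrow> real) set" where
  "signed_radon_measures =
     {\<nu>. \<exists>P N. finite_radon_measure P \<and> finite_radon_measure N \<and>
        \<nu> = (\<lambda>A. measure P A - measure N A)}"

text \<open>
  \<open>\<integral> g d\<nu>\<close> is \<open>\<integral> g dP - \<integral> g dN\<close> for any decomposition \<open>\<nu> = P - N\<close>; by the lemma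
  \<open>signed_integral_eq\<close> below, the result does not depend on the decomposition if \<open>g\<close>
  is bounded and continuous.
\<close>

definition signed_integral ::
  "('a::t2_space set \<Rightarrow> real) \<Rightarrow> ('a \<Rightarrow>\<^sub>C real) \<Rightarrow> real" where
  "signed_integral \<nu> g =
     (THE I. \<exists>P N. finite_radon_measure P \<and> finite_radon_measure N \<and>
        \<nu> = (\<lambda>A. measure P A - measure N A) \<and>
        I = (LINT x|P. apply_bcontfun g x) - (LINT x|N. apply_bcontfun g x))"

lemma integrable_bcontfun:
  fixes g :: "'a::t2_space \<Rightarrow>\<^sub>C real"
  assumes "finite_radon_measure M"
  shows "integrable M (apply_bcontfun g)"
proof -
  interpret finite_measure M using assms by (simp add: finite_radon_measure_def)
  have "sets M = sets borel" using assms by (simp add: finite_radon_measure_def)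
  moreover have "apply_bcontfun g \<in> borel_measurable borel"
    by (intro borel_measurable_continuous_onI) simp
  ultimately have "apply_bcontfun g \<in> borel_measurable M"
    by (simp cong: measurable_cong_sets)
  then show ?thesis
    by (intro integrable_const_bound[where B = "norm g"] AE_I2 norm_bounded)
qed

lemma signed_integral_eq:
  fixes g :: "'a::t2_space \<Rightarrow>\<^sub>C real"
  assumes P: "finite_radon_measure P" and N: "finite_radon_measure N"
  shows "signed_integral (\<lambda>A. measure P A - measure N A) g
       = (LINT x|P. apply_bcontfun g x) - (LINT x|N. apply_bcontfun g x)"
  unfolding signed_integral_def
proof (rule the_equality)
  show "\<exists>P' N'. finite_radon_measure P' \<and> finite_radon_measure N' \<and>
      (\<lambda>A. measure P A - measure N A) = (\<lambda>A. measure P' A - measure N' A) \<and>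
      (LINT x|P. apply_bcontfun g x) - (LINT x|N. apply_bcontfun g x)
        = (LINT x|P'. apply_bcontfun g x) - (LINT x|N'. apply_bcontfun g x)"
    using P N by blast
next
  fix I
  assume "\<exists>P' N'. finite_radon_measure P' \<and> finite_radon_measure N' \<and>
      (\<lambda>A. measure P A - measure N A) = (\<lambda>A. measure P' A - measure N' A) \<and>
      I = (LINT x|P'. apply_bcontfun g x) - (LINT x|N'. apply_bcontfun g x)"
  then obtain P' N' where P': "finite_radon_measure P'" and N': "finite_radon_measure N'"
    and eq: "\<And>A. measure P A - measure N A = measure P' A - measure N' A"
    and I: "I = (LINT x|P'. apply_bcontfun g x) - (LINT x|N'. apply_bcontfun g x)"
    by (auto simp: fun_eq_iff)
  note R = P N P' N'
  have s [measurable_cong]: "sets P = sets borel" "sets N = sets borel"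
      "sets P' = sets borel" "sets N' = sets borel"
    using R by (auto simp: finite_radon_measure_def)
  interpret P: finite_measure P using P by (simp add: finite_radon_measure_def)
  interpret N: finite_measure N using N by (simp add: finite_radon_measure_def)
  interpret P': finite_measure P' using P' by (simp add: finite_radon_measure_def)
  interpret N': finite_measure N' using N' by (simp add: finite_radon_measure_def)
  have em: "emeasure P A + emeasure N' A = emeasure P' A + emeasure N A" for A
  proof -
    have "measure P A + measure N' A = measure P' A + measure N A" using eq[of A] by simp
    then show ?thesis
      by (simp add: P.emeasure_eq_measure N.emeasure_eq_measure P'.emeasure_eq_measure
          N'.emeasure_eq_measure flip: ennreal_plus)
  qed
  have nn: "(\<integral>\<^sup>+x. f x \<partial>P) + (\<integral>\<^sup>+x. f x \<partial>N') = (\<integral>\<^sup>+x. f x \<partial>P') + (\<integral>\<^sup>+x. f x \<partial>N)"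
    if "f \<in> borel_measurable borel" for f :: "'a \<Rightarrow> ennreal"
    using that
  proof (induction rule: borel_measurable_induct)
    case (cong f h)
    then have "f = h" by (auto simp: fun_eq_iff)
    with cong show ?case by simp
  next
    case (set A)
    then show ?case using em[of A] by (simp add: s)
  next
    case (mult u c)
    then show ?case
      by (simp add: nn_integral_cmult flip: distrib_left)
  next
    case (add u v)
    then show ?case
      by (simp add: nn_integral_add add_ac)
  next
    case (seq U)
    have m: "(\<integral>\<^sup>+x. (SUP i. U i) x \<partial>M) = (SUP i. \<integral>\<^sup>+x. U i x \<partial>M)"
      if "sets M = sets borel" for M :: "'a measure"
      unfolding SUP_apply using seq that
      by (intro nn_integral_monotone_convergence_SUP) (auto cong: measurable_cong_sets)
    have i: "incseq (\<lambda>i. \<integral>\<^sup>+x. U i x \<partial>M)" for M :: "'a measure"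
      using seq(3) by (auto simp: incseq_def le_fun_def intro!: nn_integral_mono)
    have IH: "(\<lambda>i. (\<integral>\<^sup>+x. U i x \<partial>P) + (\<integral>\<^sup>+x. U i x \<partial>N'))
            = (\<lambda>i. (\<integral>\<^sup>+x. U i x \<partial>P') + (\<integral>\<^sup>+x. U i x \<partial>N))"
      using seq by (intro ext) blast
    show ?case
      by (simp only: m[OF s(1)] m[OF s(2)] m[OF s(3)] m[OF s(4)] ennreal_SUP_add[OF i i, symmetric] IH)
  qed
  define c where "c = norm g"
  define f where "f x = apply_bcontfun g x + c" for x
  have f0: "f x \<ge> 0" for x
    using norm_bounded[of g x] by (simp add: f_def c_def abs_le_iff)
  have fm: "(\<lambda>x. ennreal (f x)) \<in> borel_measurable borel"
    unfolding f_def by (intro measurable_compose[OF _ measurable_ennreal]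
        borel_measurable_continuous_onI continuous_intros) simp
  have int: "integrable M f" and li: "(LINT x|M. f x) = (LINT x|M. apply_bcontfun g x) + c * measure M UNIV"
    and nni: "(\<integral>\<^sup>+x. f x \<partial>M) = ennreal (LINT x|M. f x)"
    if M: "finite_radon_measure M" for M
  proof -
    interpret finite_measure M using M by (simp add: finite_radon_measure_def)
    have "sets M = sets borel" using M by (simp add: finite_radon_measure_def)
    then have sp: "space M = UNIV" using sets_eq_imp_space_eq by fastforce
    show i: "integrable M f"
      unfolding f_def using integrable_bcontfun[OF M] by simp
    show "(LINT x|M. f x) = (LINT x|M. apply_bcontfun g x) + c * measure M UNIV"
      unfolding f_def using integrable_bcontfun[OF M, of g] by (simp add: sp)
    show "(\<integral>\<^sup>+x. f x \<partial>M) = ennreal (LINT x|M. f x)"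
      using i f0 by (intro nn_integral_eq_integral) auto
  qed
  have "(LINT x|P. f x) + (LINT x|N'. f x) = (LINT x|P'. f x) + (LINT x|N. f x)"
    using nn[OF fm] f0 by (simp add: nni R flip: ennreal_plus)
  moreover have "c * measure P UNIV + c * measure N' UNIV = c * measure P' UNIV + c * measure N UNIV"
    using eq[of UNIV] by (simp flip: distrib_left)
  ultimately show "I = (LINT x|P. apply_bcontfun g x) - (LINT x|N. apply_bcontfun g x)"
    by (simp add: I li R)
qed

definition dirac :: "'a::t2_space \<Rightarrow> 'a set \<Rightarrow> real" where
  "dirac y = measure (return borel y)"

lemma finite_radon_measure_return: "finite_radon_measure (return borel (y::'a::t2_space))"
  unfolding finite_radon_measure_def
proof (intro conjI ballI)
  show "finite_measure (return borel y)"
    by (intro prob_space.finite_measure prob_space_return) simp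
  fix B :: "'a set" assume B: "B \<in> sets borel"
  show "emeasure (return borel y) B = (SUP C\<in>{C. C \<subseteq> B \<and> compact C}. emeasure (return borel y) C)"
  proof (rule antisym)
    show "emeasure (return borel y) B \<le> (SUP C\<in>{C. C \<subseteq> B \<and> compact C}. emeasure (return borel y) C)"
    proof (cases "y \<in> B")
      case True
      then show ?thesis using B by (intro SUP_upper2[of "{y}"]) auto
    qed (use B in simp)
    show "(SUP C\<in>{C. C \<subseteq> B \<and> compact C}. emeasure (return borel y) C) \<le> emeasure (return borel y) B"
      using B by (intro SUP_least emeasure_mono) auto
  qed
qed simp

lemma finite_radon_measure_null: "finite_radon_measure (null_measure (borel :: 'a::t2_space measure))"
  unfolding finite_radon_measure_def
proof (intro conjI ballI)
  fix B :: "'a set"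
  show "emeasure (null_measure borel) B
      = (SUP C\<in>{C. C \<subseteq> B \<and> compact C}. emeasure (null_measure (borel :: 'a measure)) C)"
    by (subst SUP_eq_const[where x = 0]) auto
qed (auto intro!: finite_measureI)

lemma dirac_signed_radon: "dirac (y::'a::t2_space) \<in> signed_radon_measures"
  unfolding signed_radon_measures_def dirac_def
  using finite_radon_measure_return[of y] finite_radon_measure_null[where 'a = 'a]
  by (intro CollectI exI[of _ "return borel y"] exI[of _ "null_measure borel"])
    (auto simp: measure_def fun_eq_iff)

lemma signed_integral_dirac: "signed_integral (dirac y) g = apply_bcontfun g (y::'a::t2_space)"
proof -
  have "apply_bcontfun g \<in> borel_measurable borel"
    by (intro borel_measurable_continuous_onI) simp
  then show ?thesis
    using signed_integral_eq[OF finite_radon_measure_return[of y]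
        finite_radon_measure_null[where 'a = 'a], of g]
    by (simp add: dirac_def integral_return)
qed

text \<open>
  The conjugate operator \<open>T\<^sup>* : M(L) \<rightarrow> M(K)\<close>: by the Riesz representation theorem, for compact
  Hausdorff spaces and bounded \<open>T\<close> there is exactly one such \<open>\<nu>\<close> for each \<open>\<mu> \<in> M(L)\<close>.
\<close>

definition conjugate_operator ::
  "(('k::t2_space \<Rightarrow>\<^sub>C real) \<Rightarrow> ('l::t2_space \<Rightarrow>\<^sub>C real)) \<Rightarrow> ('l set \<Rightarrow> real) \<Rightarrow> ('k set \<Rightarrow> real)" where
  "conjugate_operator T \<mu> =
     (THE \<nu>. \<nu> \<in> signed_radon_measures \<and> (\<forall>g. signed_integral \<nu> g = signed_integral \<mu> (T g)))"

definition phi ::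
  "(('k::t2_space \<Rightarrow>\<^sub>C real) \<Rightarrow> ('l::t2_space \<Rightarrow>\<^sub>C real)) \<Rightarrow> real \<Rightarrow> 'l \<Rightarrow> 'k set" where
  "phi T r y = {x. conjugate_operator T (dirac y) {x} \<ge> r}"

definition subsets_upto :: "nat \<Rightarrow> 'a set set" where
  "subsets_upto p = {A. finite A \<and> card A \<le> p}"

definition upper_semicontinuous ::
  "('l::topological_space \<Rightarrow> 'k::topological_space set) \<Rightarrow> bool" where
  "upper_semicontinuous \<phi> \<longleftrightarrow> (\<forall>U. open U \<longrightarrow> open {y. \<phi> y \<subseteq> U})"

end

theory Submission
  imports Defs
begin

text \<open>
  For each point \<open>y\<close> of \<open>L\<close> the functional \<open>g \<mapsto> T g y\<close> is positive and linear on \<open>C(K)\<close>, so by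
  the Riesz theorem it is integration against a unique Radon measure \<open>\<nu>\<close>, which is \<open>T\<^sup>* \<delta>\<^sub>y\<close>
  (\<open>conjugate_operator_dirac\<close>); this is a probability measure because \<open>T 1 = 1\<close>. A probability
  measure has at most \<open>1 / r\<close> atoms of mass at least \<open>r\<close>, which bounds the size of
  \<open>\<phi>\<^sub>r(y)\<close>.

  Everything else follows from a description of \<open>\<phi>\<^sub>r\<close> that mentions no measures
  (\<open>mem_phi_iff\<close>): \<open>x \<in> \<phi>\<^sub>r(y)\<close> iff \<open>r * g x \<le> T g y\<close> for all \<open>g \<ge> 0\<close>. Markov's
  inequality gives one direction; the other comes from outer regularity and Urysohn functions peaking
  at \<open>x\<close>. Each of these inequalities is a closed condition on the pair \<open>(x, y)\<close>, so \<open>\<phi>\<^sub>r\<close> has a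
  closed graph in the compact space \<open>K \<times> L\<close>. Projecting it to \<open>K\<close> shows that the union of the
  values is closed; projecting its part over the complement of \<open>U\<close> to \<open>L\<close> shows that the set of \<open>y\<close>
  with \<open>\<phi>\<^sub>r(y) \<subseteq> U\<close> is open.

  For surjectivity, fix \<open>x\<close> and look for \<open>y\<close> satisfying all the inequalities with \<open>r = m\<close>. By
  compactness of \<open>L\<close> finitely many functions may be treated at a time, and these have a common
  minorant \<open>h \<ge> 0\<close> with \<open>h x = 1\<close>, after normalisation at \<open>x\<close> (\<open>common_minorant\<close>). As \<open>T h\<close>
  has norm at least \<open>m\<close>, it takes a value at least \<open>m\<close> at some \<open>y\<close>, and by positivity of \<open>T\<close> this
  \<open>y\<close> serves all the given functions.

  The existence half of the Riesz theorem is proved by the classical construction: the mass of an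
  open set is the supremum of the functional over the continuous functions below its indicator, and
  the induced outer measure is restricted to the Borel sets by Caratheodory's lemma. Uniqueness among
  differences of Radon measures follows from regularity.
\<close>

section \<open>Continuous functions below an indicator\<close>

text \<open>
  A continuous function that vanishes off an open set \<open>U\<close> may have a support that touches the
  boundary of \<open>U\<close>. Lowering it by \<open>e > 0\<close> moves the support into the set where the function is at
  least \<open>e\<close>, a closed subset of \<open>U\<close>, at a small cost in the supremum norm. This is how the proofs
  below reach compact subsets of \<open>U\<close>.
\<close>

definition cut_off :: "real \<Rightarrow> ('a \<Rightarrow> real) \<Rightarrow> 'a \<Rightarrow> real" where
  "cut_off e f = (\<lambda>x. max (f x - e) 0)"

lemma cut_off_nonneg [simp]: "0 \<le> cut_off e f x"
  by (simp add: cut_off_def)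

lemma cut_off_continuous [continuous_intros]:
  "continuous_on S f \<Longrightarrow> continuous_on S (cut_off e f)"
  unfolding cut_off_def by (intro continuous_intros)

text \<open>
  The usual class in the Riesz construction asks for compact support inside \<open>U\<close>; the pointwise bound
  is easier to verify, and by cutting off it leads to the same suprema.
\<close>

definition below :: "'a::topological_space set \<Rightarrow> ('a \<Rightarrow> real) set" where
  "below U = {f. continuous_on UNIV f \<and> (\<forall>x. 0 \<le> f x \<and> f x \<le> indicator U x)}"

lemma belowD:
  assumes "f \<in> below U"
  shows "continuous_on UNIV f" "0 \<le> f x" "f x \<le> 1" "f x \<le> indicator U x" "x \<notin> U \<Longrightarrow> f x = 0"
proof -
  show f: "continuous_on UNIV f" "0 \<le> f x" "f x \<le> indicator U x"
    using assms by (auto simp: below_def)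
  show "f x \<le> 1"
    using f(3) by (rule order_trans) (simp add: indicator_def)
  show "x \<notin> U \<Longrightarrow> f x = 0"
    using f(2,3) by simp
qed

lemma below_nonempty [simp]: "below U \<noteq> {}"
proof -
  have "(\<lambda>x. 0) \<in> below U" by (simp add: below_def)
  then show ?thesis by blast
qed

lemma below_mono:
  assumes "U \<subseteq> V"
  shows "below U \<subseteq> below V"
proof -
  have "indicator U x \<le> (indicator V x :: real)" for x
    using assms by (auto simp: indicator_def)
  then show ?thesis unfolding below_def by (auto intro: order_trans[of _ "indicator U _"])
qed

lemma superlevel_subset:
  assumes "f \<in> below U" "0 < e"
  shows "{x. e \<le> f x} \<subseteq> U"
proof
  fix x assume "x \<in> {x. e \<le> f x}"
  then show "x \<in> U" using belowD(5)[OF assms(1), of x] assms(2) by (cases "x \<in> U") auto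
qed

lemma cut_off_below:
  assumes "f \<in> below U" "0 < e" "{x. e \<le> f x} \<subseteq> V"
  shows "cut_off e f \<in> below V"
  unfolding below_def
proof (intro CollectI conjI allI)
  fix x
  have "f x < e" if "x \<notin> V" using that assms(3) by (auto simp: not_le[symmetric])
  then show "cut_off e f x \<le> indicator V x"
    using assms(2) belowD(3)[OF assms(1), of x]
    by (cases "x \<in> V") (auto simp: cut_off_def)
qed (simp_all add: cut_off_continuous[OF belowD(1)[OF assms(1)]])

lemma closed_superlevel: "continuous_on UNIV (f :: 'a::topological_space \<Rightarrow> real) \<Longrightarrow> closed {x. e \<le> f x}"
  by (rule closed_Collect_le[OF continuous_on_const])

text \<open>
  Compact Hausdorff spaces are normal, so this is Urysohn's lemma.
\<close>

lemma Urysohn_indicator: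
  fixes C U :: "'a::t2_space set"
  assumes K: "compact (UNIV :: 'a set)" and "closed C" "open U" "C \<subseteq> U"
  shows "\<exists>f\<in>below U. \<forall>x. indicator C x \<le> f x"
proof -
  have "Hausdorff_space (euclidean :: 'a topology)"
    unfolding Hausdorff_space_def using hausdorff by (auto simp: disjnt_def)
  moreover have "compact_space (euclidean :: 'a topology)"
    using K by (simp add: compact_space_def)
  ultimately have "normal_space (euclidean :: 'a topology)"
    by (blast intro: compact_Hausdorff_or_regular_imp_normal_space)
  moreover have "closedin euclidean (- U)" "closedin euclidean C" "disjnt (- U) C"
    using assms by (auto simp: disjnt_def)
  ultimately obtain f where f: "continuous_map euclidean (top_of_set {0..1::real}) f"
    "f ` (- U) \<subseteq> {0}" "f ` C \<subseteq> {1}"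
    by (metis Urysohn_lemma zero_le_one)
  then have "continuous_on UNIV f" "\<And>x. 0 \<le> f x \<and> f x \<le> 1"
    by (auto simp: continuous_map_in_subtopology image_subset_iff Pi_iff)
  with f show ?thesis
    by (intro bexI[of _ f]) (auto simp: below_def indicator_def image_subset_iff)
qed

section \<open>The Riesz measure of a positive functional\<close>

text \<open>
  The functional is taken on plain functions, and constrained on the continuous ones only. Products,
  minima and cut-offs of continuous functions can then be written as plain terms.
\<close>

locale positive_functional =
  fixes I :: "('a::t2_space \<Rightarrow> real) \<Rightarrow> real"
  assumes compact_space: "compact (UNIV :: 'a set)"
    and add: "\<And>f g. continuous_on UNIV f \<Longrightarrow> continuous_on UNIV g \<Longrightarrow> I (\<lambda>x. f x + g x) = I f + I g"
    and scale: "\<And>c f. continuous_on UNIV f \<Longrightarrow> I (\<lambda>x. c * f x) = c * I f"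
    and nonneg: "\<And>f. continuous_on UNIV f \<Longrightarrow> (\<And>x. 0 \<le> f x) \<Longrightarrow> 0 \<le> I f"
begin

lemma zero: "I (\<lambda>x. 0) = 0"
  using scale[of "\<lambda>x. 0" 0] by simp

lemma diff: "continuous_on UNIV f \<Longrightarrow> continuous_on UNIV g \<Longrightarrow> I (\<lambda>x. f x - g x) = I f - I g"
  using add[of f "\<lambda>x. - 1 * g x"] scale[of g "- 1"] by (simp add: continuous_on_minus)

lemma mono:
  assumes "continuous_on UNIV f" "continuous_on UNIV g" "\<And>x. f x \<le> g x"
  shows "I f \<le> I g"
  using nonneg[of "\<lambda>x. g x - f x"] diff[of g f] assms by (simp add: continuous_on_diff)

lemma const: "I (\<lambda>x. c) = c * I (\<lambda>x. 1)"
  using scale[of "\<lambda>x. 1" c] by simp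

lemma sum: "(\<And>i. i \<in> S \<Longrightarrow> continuous_on UNIV (f i)) \<Longrightarrow> I (\<lambda>x. \<Sum>i\<in>S. f i x) = (\<Sum>i\<in>S. I (f i))"
proof (induction S rule: infinite_finite_induct)
  case (insert a S)
  then have "I (\<lambda>x. f a x + (\<Sum>i\<in>S. f i x)) = I (f a) + I (\<lambda>x. \<Sum>i\<in>S. f i x)"
    by (intro add continuous_intros) auto
  with insert show ?case by simp
qed (simp_all add: zero)

lemma total_nonneg: "0 \<le> I (\<lambda>x. 1)"
  by (intro nonneg continuous_intros) simp

lemma compact_superlevel: "continuous_on UNIV f \<Longrightarrow> compact {x. e \<le> f x}" for f :: "'a \<Rightarrow> real"
  using compact_Int_closed[OF compact_space closed_superlevel] by simp

text \<open>
  Cutting off at height \<open>e\<close> costs at most \<open>e * I 1\<close>, which is arbitrarily small. The summand \<open>c\<close>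
  is there for the Caratheodory splitting, where a second mass is carried along.
\<close>

lemma le_by_cut_off:
  assumes f: "continuous_on UNIV f" and X: "\<And>e. 0 < e \<Longrightarrow> ennreal (I (cut_off e f)) + c \<le> X"
  shows "ennreal (I f) + c \<le> X"
proof (rule ennreal_le_epsilon)
  fix d :: real assume d: "0 < d"
  define e where "e = d / (I (\<lambda>x. 1) + 1)"
  have e: "0 < e" using d total_nonneg by (simp add: e_def)
  have "e * (I (\<lambda>x. 1) + 1) = d" using total_nonneg by (simp add: e_def)
  then have ed: "e * I (\<lambda>x. 1) \<le> d" using e by (simp add: algebra_simps)
  have "I f \<le> I (\<lambda>x. cut_off e f x + e)"
    using f by (intro mono continuous_intros) (auto simp: cut_off_def)
  also have "\<dots> = I (cut_off e f) + e * I (\<lambda>x. 1)"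
    using f by (subst add) (auto simp: const[of e] intro!: continuous_intros)
  also have "\<dots> \<le> I (cut_off e f) + d" using ed by simp
  finally have "ennreal (I f) \<le> ennreal (I (cut_off e f) + d)"
    by (rule ennreal_leI)
  also have "\<dots> = ennreal (I (cut_off e f)) + ennreal d"
    using f d by (intro ennreal_plus nonneg continuous_intros) auto
  finally have "ennreal (I f) + c \<le> (ennreal (I (cut_off e f)) + c) + ennreal d"
    by (simp add: add_ac add_left_mono)
  also have "\<dots> \<le> X + ennreal d" using X[OF e] by (rule add_right_mono)
  finally show "ennreal (I f) + c \<le> X + ennreal d" .
qed

definition open_mass :: "'a set \<Rightarrow> ennreal" where
  "open_mass U = (SUP f\<in>below U. ennreal (I f))"

lemma open_mass_upper: "f \<in> below U \<Longrightarrow> ennreal (I f) \<le> open_mass U"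
  unfolding open_mass_def by (rule SUP_upper)

lemma open_mass_mono: "U \<subseteq> V \<Longrightarrow> open_mass U \<le> open_mass V"
  unfolding open_mass_def by (intro SUP_subset_mono below_mono) auto

lemma open_mass_least:
  assumes "\<And>f e. f \<in> below U \<Longrightarrow> 0 < e \<Longrightarrow> ennreal (I (cut_off e f)) \<le> X"
  shows "open_mass U \<le> X"
  unfolding open_mass_def
proof (rule SUP_least)
  fix f assume f: "f \<in> below U"
  show "ennreal (I f) \<le> X"
    using le_by_cut_off[OF belowD(1)[OF f], of 0 X] assms[OF f] by simp
qed

lemma open_mass_empty: "open_mass {} = 0"
proof -
  have "below {} = {\<lambda>x::'a. 0 :: real}"
    by (auto simp: below_def fun_eq_iff intro: antisym)
  then show ?thesis by (simp add: open_mass_def zero)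
qed

lemma open_mass_UNIV: "open_mass UNIV = ennreal (I (\<lambda>x. 1))"
  unfolding open_mass_def
  by (intro antisym SUP_least SUP_upper2[of "\<lambda>x. 1"] ennreal_leI mono)
    (auto simp: below_def)

text \<open>
  On the compact set \<open>C\<close> where \<open>f\<close> is at least \<open>e\<close>, a Urysohn function \<open>h\<close> that is \<open>1\<close> on
  \<open>C - U\<close> and \<open>0\<close> off \<open>V\<close> acts as a two-element partition of unity: it splits the cut-off of \<open>f\<close>
  into a part below \<open>U\<close> and a part below \<open>V\<close>.
\<close>

lemma open_mass_Un:
  assumes "open U" "open V"
  shows "open_mass (U \<union> V) \<le> open_mass U + open_mass V"
proof (rule open_mass_least)
  fix f e assume f: "f \<in> below (U \<union> V)" and e: "0 < (e::real)"
  note fc = belowD(1)[OF f]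
  define C where "C = {x. e \<le> f x}"
  have C: "closed C" "C \<subseteq> U \<union> V"
    unfolding C_def using closed_superlevel[OF fc] superlevel_subset[OF f e] by auto
  obtain h where hV: "h \<in> below V" and h2: "\<And>x. indicator (C - U) x \<le> h x"
    using Urysohn_indicator[OF compact_space, of "C - U" V] C assms by auto
  note h = belowD(1)[OF hV] h2 belowD(4)[OF hV]
  have h01: "0 \<le> h x" "h x \<le> 1" for x
    using belowD(2,3)[OF hV] by auto
  have g01: "cut_off e f x \<le> 1" for x
    using belowD(2,3)[OF f, of x] e by (auto simp: cut_off_def)
  have gC: "cut_off e f x = 0" if "x \<notin> C" for x
    using that by (auto simp: cut_off_def C_def)
  have V: "(\<lambda>x. cut_off e f x * h x) \<in> below V"
    unfolding below_def
  proof (intro CollectI conjI allI)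
    show "continuous_on UNIV (\<lambda>x. cut_off e f x * h x)" using fc h by (intro continuous_intros)
    fix x show "0 \<le> cut_off e f x * h x" using h01 by simp
    show "cut_off e f x * h x \<le> indicator V x"
      using mult_mono[OF g01 h(3), of x x] h01(1)[of x] by simp
  qed
  have U: "(\<lambda>x. cut_off e f x * (1 - h x)) \<in> below U"
    unfolding below_def
  proof (intro CollectI conjI allI)
    show "continuous_on UNIV (\<lambda>x. cut_off e f x * (1 - h x))" using fc h by (intro continuous_intros)
    fix x show "0 \<le> cut_off e f x * (1 - h x)" using h01 by simp
    show "cut_off e f x * (1 - h x) \<le> indicator U x"
    proof (cases "x \<in> U")
      case True
      then show ?thesis using mult_mono[OF g01, of "1 - h x" 1 x] h01[of x] by simp
    next
      case False
      then have "cut_off e f x = 0 \<or> h x = 1"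
        using gC[of x] h(2)[of x] h01[of x] by (cases "x \<in> C") auto
      then show ?thesis by (auto simp: indicator_def)
    qed
  qed
  have "I (cut_off e f) = I (\<lambda>x. cut_off e f x * (1 - h x) + cut_off e f x * h x)"
    by (simp add: algebra_simps)
  also have "\<dots> = I (\<lambda>x. cut_off e f x * (1 - h x)) + I (\<lambda>x. cut_off e f x * h x)"
    using fc h by (intro add continuous_intros)
  finally have "ennreal (I (cut_off e f))
      = ennreal (I (\<lambda>x. cut_off e f x * (1 - h x))) + ennreal (I (\<lambda>x. cut_off e f x * h x))"
    using U V by (simp add: below_def nonneg)
  also have "\<dots> \<le> open_mass U + open_mass V" using U V by (intro add_mono open_mass_upper)
  finally show "ennreal (I (cut_off e f)) \<le> open_mass U + open_mass V" .
qed

lemma open_mass_UN_finite: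
  fixes U :: "nat \<Rightarrow> 'a set"
  assumes "\<And>i. open (U i)"
  shows "open_mass (\<Union>i<n. U i) \<le> (\<Sum>i<n. open_mass (U i))"
proof (induction n)
  case (Suc n)
  have "open_mass (\<Union>i<Suc n. U i) = open_mass ((\<Union>i<n. U i) \<union> U n)"
    by (simp add: lessThan_Suc Un_commute)
  also have "\<dots> \<le> open_mass (\<Union>i<n. U i) + open_mass (U n)" using assms by (intro open_mass_Un) auto
  finally show ?case using Suc by (simp add: order_trans add_right_mono)
qed (simp add: open_mass_empty)

text \<open>
  The cut-off of \<open>f\<close> lives on a compact set, which finitely many of the open sets cover; so the
  countable case reduces to the finite one.
\<close>

lemma open_mass_UN:
  fixes U :: "nat \<Rightarrow> 'a set"
  assumes U: "\<And>i. open (U i)"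
  shows "open_mass (\<Union>i. U i) \<le> (\<Sum>i. open_mass (U i))"
proof (rule open_mass_least)
  fix f e assume f: "f \<in> below (\<Union>i. U i)" and e: "0 < (e::real)"
  have "{x. e \<le> f x} \<subseteq> (\<Union>i. U i)"
    using superlevel_subset[OF f e] .
  then obtain S where S: "finite S" "{x. e \<le> f x} \<subseteq> (\<Union>i\<in>S. U i)"
    using compactE_image[OF compact_superlevel[OF belowD(1)[OF f]], of UNIV U e] U by auto
  obtain n where "S \<subseteq> {..<n}" using S(1) finite_nat_iff_bounded by blast
  with S have "cut_off e f \<in> below (\<Union>i<n. U i)"
    using f e by (intro cut_off_below) auto
  then have "ennreal (I (cut_off e f)) \<le> open_mass (\<Union>i<n. U i)" by (rule open_mass_upper)
  also have "\<dots> \<le> (\<Sum>i<n. open_mass (U i))" using U by (rule open_mass_UN_finite)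
  also have "\<dots> \<le> (\<Sum>i. open_mass (U i))" by (intro sum_le_suminf) auto
  finally show "ennreal (I (cut_off e f)) \<le> (\<Sum>i. open_mass (U i))" .
qed

definition outer :: "'a set \<Rightarrow> ennreal" where
  "outer A = (INF U\<in>{U. open U \<and> A \<subseteq> U}. open_mass U)"

lemma outer_le: "open U \<Longrightarrow> A \<subseteq> U \<Longrightarrow> outer A \<le> open_mass U"
  unfolding outer_def by (rule INF_lower) simp

lemma outer_open: "open U \<Longrightarrow> outer U = open_mass U"
  unfolding outer_def by (intro antisym INF_greatest INF_lower) (auto intro: open_mass_mono)

lemma outer_mono: "A \<subseteq> B \<Longrightarrow> outer A \<le> outer B"
  unfolding outer_def by (intro INF_superset_mono) auto

lemma outer_finite: "outer A < top"
  using outer_le[of UNIV A] by (simp add: open_mass_UNIV order_le_less_trans)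

lemma outer_approx:
  assumes "0 < (e::real)"
  obtains U where "open U" "A \<subseteq> U" "open_mass U \<le> outer A + ennreal e"
proof -
  have "outer A < outer A + ennreal e"
    using outer_finite[of A] assms
    by (cases "outer A") (auto simp: ennreal_less_iff simp flip: ennreal_plus)
  then show thesis
    using that unfolding outer_def INF_less_iff by (auto intro: less_imp_le)
qed

lemma outer_countably_subadditive: "outer (\<Union>i::nat. A i) \<le> (\<Sum>i. outer (A i))"
proof (rule ennreal_le_epsilon)
  fix e :: real assume e: "0 < e"
  have "\<exists>U. open U \<and> A i \<subseteq> U \<and> open_mass U \<le> outer (A i) + ennreal (e * (1/2) ^ Suc i)" for i
    using outer_approx[of "e * (1/2) ^ Suc i" "A i"] e by (metis mult_pos_pos half_gt_zero_iff zero_less_one zero_less_power)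
  then obtain U where U: "\<And>i. open (U i)" "\<And>i. A i \<subseteq> U i"
    "\<And>i. open_mass (U i) \<le> outer (A i) + ennreal (e * (1/2) ^ Suc i)"
    by metis
  have "outer (\<Union>i. A i) \<le> open_mass (\<Union>i. U i)" using U by (intro outer_le) auto
  also have "\<dots> \<le> (\<Sum>i. open_mass (U i))" using U(1) by (rule open_mass_UN)
  also have "\<dots> \<le> (\<Sum>i. outer (A i) + ennreal (e * (1/2) ^ Suc i))"
    using U(3) by (intro suminf_le) auto
  also have "\<dots> = (\<Sum>i. outer (A i)) + (\<Sum>i. ennreal (e * (1/2) ^ Suc i))"
    by (simp add: suminf_add)
  also have "(\<Sum>i. ennreal (e * (1/2) ^ Suc i)) = ennreal e"
    using sums_mult[OF power_half_series, of e] e by (intro suminf_ennreal_eq) auto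
  finally show "outer (\<Union>i. A i) \<le> (\<Sum>i. outer (A i)) + ennreal e" .
qed

lemma outer_measure_space: "outer_measure_space UNIV outer"
  unfolding outer_measure_space_def positive_def increasing_def countably_subadditive_def
  using outer_open[of "{}"] open_mass_empty outer_mono outer_countably_subadditive by auto

text \<open>
  The Caratheodory condition for open sets, tested on open sets. If \<open>f\<close> is below \<open>W\<close> and \<open>C\<close> is
  the closed set where it is at least \<open>e\<close>, then its cut-off vanishes off \<open>C\<close>, so any \<open>g\<close> below
  \<open>V - C\<close> can be added to it without leaving the functions below \<open>V\<close>; and \<open>V - C\<close> is an open set
  containing \<open>V - W\<close>.
\<close>

lemma open_mass_split:
  assumes W: "open W" and V: "open V" and WV: "W \<subseteq> V"
  shows "open_mass W + outer (V - W) \<le> open_mass V"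
proof -
  have "ennreal (I f) + outer (V - W) \<le> open_mass V" if f: "f \<in> below W" for f
  proof (rule le_by_cut_off[OF belowD(1)[OF f]])
    fix e :: real assume e: "0 < e"
    note fc = belowD(1)[OF f]
    define C where "C = {x. e \<le> f x}"
    have C: "closed C" "C \<subseteq> W"
      unfolding C_def using closed_superlevel[OF fc] superlevel_subset[OF f e] by auto
    have "outer (V - W) \<le> open_mass (V - C)" using V C by (intro outer_le) auto
    then have "ennreal (I (cut_off e f)) + outer (V - W)
        \<le> (SUP g\<in>below (V - C). ennreal (I (cut_off e f)) + ennreal (I g))"
      unfolding open_mass_def by (subst ennreal_SUP_add_right[symmetric]) (auto intro: add_left_mono)
    also have "\<dots> \<le> open_mass V"
    proof (rule SUP_least)
      fix g assume g: "g \<in> below (V - C)"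
      have "(\<lambda>x. cut_off e f x + g x) \<in> below V"
        unfolding below_def
      proof (intro CollectI conjI allI)
        show "continuous_on UNIV (\<lambda>x. cut_off e f x + g x)"
          using fc belowD(1)[OF g] by (intro continuous_intros)
        fix x show "0 \<le> cut_off e f x + g x" using belowD(2)[OF g, of x] by simp
        show "cut_off e f x + g x \<le> indicator V x"
        proof (cases "x \<in> C")
          case True
          then show ?thesis
            using C WV e belowD(5)[OF g, of x] belowD(2,3)[OF f, of x] by (auto simp: cut_off_def)
        next
          case False
          then have "cut_off e f x = 0" by (auto simp: C_def cut_off_def)
          then show ?thesis using belowD(4)[OF g, of x] False by (auto simp: indicator_def split: if_splits)
        qed
      qed
      from open_mass_upper[OF this] show "ennreal (I (cut_off e f)) + ennreal (I g) \<le> open_mass V"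
        using fc belowD(1,2)[OF g] by (simp add: add nonneg cut_off_continuous)
    qed
    finally show "ennreal (I (cut_off e f)) + outer (V - W) \<le> open_mass V" .
  qed
  then show ?thesis
    unfolding open_mass_def[of W]
    by (subst ennreal_SUP_add_left[symmetric]) (auto intro!: SUP_least)
qed

lemma open_in_lambda_system:
  assumes U: "open U"
  shows "U \<in> lambda_system UNIV UNIV outer"
proof -
  interpret sigma_algebra "UNIV :: 'a set" UNIV using sigma_algebra_Pow[of UNIV] by simp
  have sub: "subadditive UNIV outer"
    using outer_measure_space countably_subadditive_subadditive[of outer]
    unfolding outer_measure_space_def by simp
  have "outer (A \<inter> U) + outer (A - U) \<le> outer A" for A
  proof -
    have "outer (A \<inter> U) + outer (A - U) \<le> open_mass V" if V: "open V" "A \<subseteq> V" for V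
    proof -
      have "outer (A \<inter> U) + outer (A - U) \<le> open_mass (V \<inter> U) + outer (V - V \<inter> U)"
        using V U by (intro add_mono outer_le outer_mono) auto
      also have "\<dots> \<le> open_mass V" using V U by (intro open_mass_split) auto
      finally show ?thesis .
    qed
    then show ?thesis unfolding outer_def[of A] by (auto intro: INF_greatest)
  qed
  moreover have "outer A \<le> outer (A \<inter> U) + outer (A - U)" for A
    using subadditiveD[OF sub, of "A \<inter> U" "A - U"] by (auto simp: Int_Diff_Un)
  ultimately show ?thesis
    unfolding lambda_system_eq by (auto intro: antisym)
qed

definition riesz_measure :: "'a measure" where
  "riesz_measure = measure_of UNIV (sets borel) outer"

lemma
  shows space_riesz_measure [simp]: "space riesz_measure = UNIV"
    and sets_riesz_measure [simp, measurable_cong]: "sets riesz_measure = sets borel"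
  by (simp_all add: riesz_measure_def sets_measure_of_conv space_measure_of_conv sets.sigma_sets_eq[of borel, simplified])

lemma emeasure_riesz_measure:
  assumes "A \<in> sets borel"
  shows "emeasure riesz_measure A = outer A"
proof -
  interpret sigma_algebra "UNIV :: 'a set" UNIV using sigma_algebra_Pow[of UNIV] by simp
  note ms = caratheodory_lemma[OF outer_measure_space]
  have sa: "sigma_algebra UNIV (sets (borel :: 'a measure))"
    using sets.sigma_algebra_axioms[of "borel :: 'a measure"] by simp
  have "sigma_algebra UNIV (lambda_system UNIV UNIV outer)"
    using ms by (simp add: measure_space_def)
  then have "sets borel \<subseteq> lambda_system UNIV UNIV outer"
    unfolding borel_def
    using sigma_algebra.sigma_sets_subset[of UNIV "lambda_system UNIV UNIV outer" "Collect open"]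
      open_in_lambda_system by auto
  from measure_down[OF ms sa this] show ?thesis
    unfolding riesz_measure_def using assms sa
    by (intro emeasure_measure_of_sigma) (auto simp: measure_space_def)
qed

lemma emeasure_riesz_measure_open: "open U \<Longrightarrow> emeasure riesz_measure U = open_mass U"
  by (simp add: emeasure_riesz_measure outer_open)

lemma finite_measure_riesz_measure: "finite_measure riesz_measure"
  by (intro finite_measureI) (simp add: emeasure_riesz_measure_open open_mass_UNIV)

lemma measure_riesz_measure_UNIV: "measure riesz_measure UNIV = I (\<lambda>x. 1)"
  by (simp add: measure_def emeasure_riesz_measure_open open_mass_UNIV total_nonneg)

text \<open>
  Outer regularity is built into the outer measure. In a compact space, outer regularity for the
  complement of \<open>B\<close> is inner regularity for \<open>B\<close>.
\<close>

lemma finite_radon_riesz_measure: "finite_radon_measure riesz_measure"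
  unfolding finite_radon_measure_def
proof (intro conjI ballI finite_measure_riesz_measure)
  interpret finite_measure riesz_measure by (rule finite_measure_riesz_measure)
  fix B :: "'a set" assume B: "B \<in> sets borel"
  show "emeasure riesz_measure B = (SUP C\<in>{C. C \<subseteq> B \<and> compact C}. emeasure riesz_measure C)"
  proof (rule antisym)
    show "(SUP C\<in>{C. C \<subseteq> B \<and> compact C}. emeasure riesz_measure C) \<le> emeasure riesz_measure B"
      using B by (intro SUP_least emeasure_mono) auto
    show "emeasure riesz_measure B \<le> (SUP C\<in>{C. C \<subseteq> B \<and> compact C}. emeasure riesz_measure C)"
    proof (rule ennreal_le_epsilon)
      fix e :: real assume e: "0 < e"
      obtain U where U: "open U" "- B \<subseteq> U" "open_mass U \<le> outer (- B) + ennreal e"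
        using outer_approx[OF e] by blast
      then have "emeasure riesz_measure U \<le> emeasure riesz_measure (- B) + ennreal e"
        using B by (simp add: emeasure_riesz_measure_open emeasure_riesz_measure)
      then have "measure riesz_measure U \<le> measure riesz_measure (- B) + e"
        using e by (simp add: emeasure_eq_measure flip: ennreal_plus)
      moreover have "measure riesz_measure (- A) = measure riesz_measure UNIV - measure riesz_measure A"
        if "A \<in> sets borel" for A
        using finite_measure_compl[of A] that by (simp add: Compl_eq_Diff_UNIV)
      ultimately have "measure riesz_measure B \<le> measure riesz_measure (- U) + e"
        using U(1) B by simp
      then have "emeasure riesz_measure B \<le> emeasure riesz_measure (- U) + ennreal e"
        using e by (simp add: emeasure_eq_measure flip: ennreal_plus)
      moreover have "compact (- U)"
        using compact_space U(1) by (metis compact_Int_closed closed_Compl inf_top_left)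
      then have "emeasure riesz_measure (- U)
          \<le> (SUP C\<in>{C. C \<subseteq> B \<and> compact C}. emeasure riesz_measure C)"
        using U(2) by (intro SUP_upper) auto
      ultimately show "emeasure riesz_measure B
          \<le> (SUP C\<in>{C. C \<subseteq> B \<and> compact C}. emeasure riesz_measure C) + ennreal e"
        by (meson add_right_mono order_trans)
    qed
  qed
qed simp

lemma below_le_measure:
  assumes "open U" "f \<in> below U"
  shows "I f \<le> measure riesz_measure U"
proof -
  interpret finite_measure riesz_measure by (rule finite_measure_riesz_measure)
  show ?thesis
    using open_mass_upper[OF assms(2)] assms(1)
    by (simp flip: emeasure_riesz_measure_open add: emeasure_eq_measure)
qed

lemma integrable_below:
  assumes "f \<in> below U"
  shows "integrable riesz_measure f"
proof -
  interpret finite_measure riesz_measure by (rule finite_measure_riesz_measure)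
  have "f \<in> borel_measurable borel"
    using belowD(1)[OF assms] by (rule borel_measurable_continuous_onI)
  then show ?thesis
    using belowD(2,3)[OF assms] by (intro integrable_const_bound[where B = 1]) auto
qed

text \<open>
  The layer-cake argument. Cut \<open>f\<close> into \<open>n\<close> horizontal slices \<open>s i\<close> of height \<open>1 / n\<close>. The
  \<open>i\<close>-th slice lies between the indicators of \<open>G (i + 1)\<close> and \<open>G i\<close>, scaled by \<open>1 / n\<close>, where
  \<open>G i\<close> is the open set on which \<open>f\<close> exceeds \<open>i / n\<close>. The upper bound controls \<open>I\<close> of the slice
  by the definition of the mass of \<open>G i\<close>, the lower bound controls its integral. After shifting
  the index by one, the two estimates differ only by the bottom term, at most \<open>I 1 / n\<close>.
\<close>

lemma le_integral_below:
  assumes f: "f \<in> below UNIV"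
  shows "I f \<le> (LINT x|riesz_measure. f x)"
proof (rule field_le_epsilon)
  interpret finite_measure riesz_measure by (rule finite_measure_riesz_measure)
  note fc = belowD(1)[OF f]
  fix e :: real assume e: "0 < e"
  obtain n :: nat where n: "I (\<lambda>x. 1) / e < real n" using reals_Archimedean2 by blast
  then have n0: "0 < n" using e total_nonneg by (auto intro!: gr0I simp: field_simps)
  define s where "s i = (\<lambda>x. min (cut_off (real i / n) f x) (1 / n))" for i :: nat
  define G where "G i = {x. real i / n < f x}" for i :: nat
  have G: "open (G i)" for i
    unfolding G_def using fc by (intro open_Collect_less continuous_on_const)
  have sc: "continuous_on UNIV (s i)" for i
    unfolding s_def using fc by (intro continuous_intros)
  have sb: "(\<lambda>x. real n * s i x) \<in> below (G i)" for i
    unfolding below_def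
  proof (intro CollectI conjI allI)
    show "continuous_on UNIV (\<lambda>x. real n * s i x)" using sc by (intro continuous_intros)
    fix x show "0 \<le> real n * s i x" by (simp add: s_def)
    have "real n * s i x \<le> real n * (1 / n)"
      by (intro mult_left_mono) (auto simp: s_def)
    moreover have "s i x = 0" if "x \<notin> G i"
      using that by (simp add: s_def cut_off_def G_def)
    ultimately show "real n * s i x \<le> indicator (G i) x"
      using n0 by (auto simp: indicator_def)
  qed
  have si: "integrable riesz_measure (s i)" for i
    using integrable_mult_right[OF integrable_below[OF sb[of i]], of "1 / n"] n0 by simp
  have "(\<Sum>i<k. s i x) = min (f x) (real k / n)" for k x
  proof (induction k)
    case 0
    then show ?case using belowD(2)[OF f] by simp
  next
    case (Suc k)
    have "min (f x) (real k / n) + min (max (f x - real k / n) 0) (1 / n) = min (f x) (real k / n + 1 / n)"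
      using divide_nonneg_nonneg[of 1 "real n"] by linarith
    with Suc show ?case by (simp add: s_def cut_off_def add_divide_distrib add.commute)
  qed
  then have fs: "(\<lambda>x. \<Sum>i<n. s i x) = f"
    using n0 belowD(3)[OF f] by (simp add: fun_eq_iff)
  have up: "I (s i) \<le> measure riesz_measure (G i) / n" for i
    using below_le_measure[OF G sb, of i] n0 by (simp add: scale sc field_simps)
  have lo: "measure riesz_measure (G (Suc i)) / n \<le> (LINT x|riesz_measure. s i x)" for i
  proof -
    have "(LINT x|riesz_measure. indicator (G (Suc i)) x * (1 / n)) \<le> (LINT x|riesz_measure. s i x)"
    proof (intro integral_mono si)
      show "integrable riesz_measure (\<lambda>x. indicator (G (Suc i)) x * (1 / n) :: real)"
        using G by (intro integrable_mult_left integrable_real_indicator) (auto simp: emeasure_eq_measure)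
      fix x show "indicator (G (Suc i)) x * (1 / n) \<le> s i x"
        by (auto simp: indicator_def G_def s_def cut_off_def add_divide_distrib)
    qed
    then show ?thesis using G by simp
  qed
  have "I f = (\<Sum>i<n. I (s i))"
    using sum[of "{..<n}" s] sc fs by simp
  also have "\<dots> \<le> (\<Sum>i<n. measure riesz_measure (G i) / n)" by (intro sum_mono up)
  also have "\<dots> \<le> (\<Sum>i<Suc n. measure riesz_measure (G i) / n)" by simp
  also have "\<dots> = measure riesz_measure (G 0) / n + (\<Sum>i<n. measure riesz_measure (G (Suc i)) / n)"
    by (rule sum.lessThan_Suc_shift)
  also have "\<dots> \<le> e + (\<Sum>i<n. LINT x|riesz_measure. s i x)"
  proof (intro add_mono sum_mono lo)
    have "measure riesz_measure (G 0) \<le> I (\<lambda>x. 1)"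
      unfolding measure_riesz_measure_UNIV[symmetric] using G by (intro finite_measure_mono) auto
    also have "\<dots> \<le> e * n" using n e by (simp add: field_simps)
    finally show "measure riesz_measure (G 0) / n \<le> e" using n0 by (simp add: field_simps)
  qed
  also have "(\<Sum>i<n. LINT x|riesz_measure. s i x) = (LINT x|riesz_measure. f x)"
    using Bochner_Integration.integral_sum[of "{..<n}" riesz_measure s] si fs by simp
  finally show "I f \<le> (LINT x|riesz_measure. f x) + e" by simp
qed

text \<open>
  Applying the inequality to \<open>1 - f\<close> as well gives equality, since \<open>I 1\<close> is the total mass.
\<close>

lemma integral_below:
  assumes f: "f \<in> below UNIV"
  shows "(LINT x|riesz_measure. f x) = I f"
proof (rule antisym)
  interpret finite_measure riesz_measure by (rule finite_measure_riesz_measure)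
  note fc = belowD(1)[OF f]
  have "(\<lambda>x. 1 - f x) \<in> below UNIV"
    using belowD(2,3)[OF f] fc by (auto simp: below_def intro!: continuous_intros)
  from le_integral_below[OF this]
  show "(LINT x|riesz_measure. f x) \<le> I f"
    using fc integrable_below[OF f]
    by (simp add: diff continuous_on_const measure_riesz_measure_UNIV)
qed (rule le_integral_below[OF f])

theorem integral_riesz_measure:
  assumes f: "continuous_on UNIV f"
  shows "(LINT x|riesz_measure. f x) = I f"
proof -
  interpret finite_measure riesz_measure by (rule finite_measure_riesz_measure)
  have "bounded (range f)"
    using compact_continuous_image[OF f compact_space] by (rule compact_imp_bounded)
  then obtain b where b: "0 < b" "\<And>x. \<bar>f x\<bar> \<le> b"
    unfolding bounded_pos by auto
  \<comment> \<open>An affine change of scale brings the range of \<open>f\<close> into the unit interval.\<close>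
  define h where "h = (\<lambda>x. (f x + b) / (2 * b))"
  have h: "h \<in> below UNIV"
    unfolding below_def h_def
  proof (intro CollectI conjI allI)
    show "continuous_on UNIV (\<lambda>x. (f x + b) / (2 * b))"
      using f b(1) by (intro continuous_intros) auto
    fix x
    show "0 \<le> (f x + b) / (2 * b)" "(f x + b) / (2 * b) \<le> indicator UNIV x"
      using b(1) b(2)[of x] by (auto simp: field_simps abs_le_iff)
  qed
  have fh: "f = (\<lambda>x. 2 * b * h x - b)"
    using b(1) by (auto simp: h_def)
  have "I f = 2 * b * I h - b * I (\<lambda>x. 1)"
    using belowD(1)[OF h] by (subst fh) (simp add: diff scale const[of b] continuous_on_mult_left)
  moreover have "(LINT x|riesz_measure. f x) = 2 * b * (LINT x|riesz_measure. h x) - b * I (\<lambda>x. 1)"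
    using integrable_below[OF h] by (subst fh) (simp add: measure_riesz_measure_UNIV)
  ultimately show ?thesis using integral_below[OF h] by simp
qed

end

section \<open>Regularity and uniqueness of the representing measure\<close>

lemma finite_radon_measureD:
  assumes "finite_radon_measure M"
  shows "finite_measure M" "sets M = sets borel" "space M = UNIV"
  using assms sets_eq_imp_space_eq[of M borel] by (auto simp: finite_radon_measure_def)

lemma finite_radon_inner:
  assumes M: "finite_radon_measure M" and B: "B \<in> sets borel" and e: "0 < (e::real)"
  shows "\<exists>C. compact C \<and> C \<subseteq> B \<and> measure M B \<le> measure M C + e"
proof (cases "measure M B \<le> e")
  case True
  \<comment> \<open>Here \<open>measure M B - e\<close> is not positive, and the empty set will do.\<close>
  then show ?thesis by (intro exI[of _ "{}"]) auto
next
  case False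
  interpret finite_measure M using M by (rule finite_radon_measureD)
  have "ennreal (measure M B - e) < emeasure M B"
    using False e by (simp add: emeasure_eq_measure ennreal_less_iff)
  also have "emeasure M B = (SUP C\<in>{C. C \<subseteq> B \<and> compact C}. emeasure M C)"
    using M B by (simp add: finite_radon_measure_def)
  finally obtain C where C: "C \<subseteq> B" "compact C" "ennreal (measure M B - e) < emeasure M C"
    unfolding less_SUP_iff by auto
  then have "measure M B - e < measure M C"
    using False by (simp add: emeasure_eq_measure ennreal_less_iff)
  with C show ?thesis by (intro exI[of _ C]) auto
qed

lemma finite_radon_outer:
  assumes M: "finite_radon_measure M" and B: "B \<in> sets borel" and e: "0 < (e::real)"
  shows "\<exists>U. open U \<and> B \<subseteq> U \<and> measure M U \<le> measure M B + e"
proof -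
  interpret finite_measure M using M by (rule finite_radon_measureD)
  note [simp] = finite_radon_measureD[OF M]
  obtain C where C: "compact C" "C \<subseteq> - B" "measure M (- B) \<le> measure M C + e"
    using finite_radon_inner[OF M _ e, of "- B"] B by auto
  have cl: "closed C" using C(1) by (rule compact_imp_closed)
  have "measure M (- A) = measure M UNIV - measure M A" if "A \<in> sets borel" for A
    using finite_measure_compl[of A] that by (simp add: Compl_eq_Diff_UNIV)
  then show ?thesis
    using C cl B by (intro exI[of _ "- C"]) auto
qed

lemma finite_radon_inner_simultaneous:
  assumes "finite S" and M: "\<And>M. M \<in> S \<Longrightarrow> finite_radon_measure M"
    and B: "B \<in> sets borel" and e: "0 < (e::real)"
  shows "\<exists>C. compact C \<and> C \<subseteq> B \<and> (\<forall>M\<in>S. measure M B \<le> measure M C + e)"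
proof -
  have "\<forall>M\<in>S. \<exists>C. compact C \<and> C \<subseteq> B \<and> measure M B \<le> measure M C + e"
    using finite_radon_inner[OF M B e] by blast
  then obtain C where C: "\<And>M. M \<in> S \<Longrightarrow> compact (C M)" "\<And>M. M \<in> S \<Longrightarrow> C M \<subseteq> B"
    "\<And>M. M \<in> S \<Longrightarrow> measure M B \<le> measure M (C M) + e"
    by metis
  define D where "D = (\<Union>M\<in>S. C M)"
  have D: "compact D" unfolding D_def using assms(1) C(1) by (intro compact_UN)
  have "measure M B \<le> measure M D + e" if "M \<in> S" for M
  proof -
    interpret finite_measure M using M[OF that] by (rule finite_radon_measureD)
    have "measure M (C M) \<le> measure M D"
      using that compact_imp_closed[OF D] by (intro finite_measure_mono)
        (auto simp: D_def finite_radon_measureD[OF M[OF that]])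
    with C(3)[OF that] show ?thesis by simp
  qed
  with D C(2) show ?thesis by (intro exI[of _ D]) (auto simp: D_def)
qed

lemma finite_radon_outer_simultaneous:
  assumes "finite S" and M: "\<And>M. M \<in> S \<Longrightarrow> finite_radon_measure M"
    and B: "B \<in> sets borel" and e: "0 < (e::real)"
  shows "\<exists>U. open U \<and> B \<subseteq> U \<and> (\<forall>M\<in>S. measure M U \<le> measure M B + e)"
proof -
  have "\<forall>M\<in>S. \<exists>U. open U \<and> B \<subseteq> U \<and> measure M U \<le> measure M B + e"
    using finite_radon_outer[OF M B e] by blast
  then obtain U where U: "\<And>M. M \<in> S \<Longrightarrow> open (U M)" "\<And>M. M \<in> S \<Longrightarrow> B \<subseteq> U M"
    "\<And>M. M \<in> S \<Longrightarrow> measure M (U M) \<le> measure M B + e"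
    by metis
  define V where "V = (\<Inter>M\<in>S. U M)"
  have V: "open V" unfolding V_def using assms(1) U(1) by (intro open_INT) auto
  have "measure M V \<le> measure M B + e" if "M \<in> S" for M
  proof -
    interpret finite_measure M using M[OF that] by (rule finite_radon_measureD)
    have "measure M V \<le> measure M (U M)"
      using that U(1)[OF that] by (intro finite_measure_mono)
        (auto simp: V_def finite_radon_measureD[OF M[OF that]])
    with U(3)[OF that] show ?thesis by simp
  qed
  with V U(2) show ?thesis by (intro exI[of _ V]) (auto simp: V_def)
qed

lemma apply_Bcontfun:
  assumes "compact (UNIV :: 'a::topological_space set)" "continuous_on UNIV (f :: 'a \<Rightarrow> real)"
  shows "apply_bcontfun (Bcontfun f) = f"
  using assms compact_imp_bounded[OF compact_continuous_image[OF assms(2,1)]]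
  by (simp add: Bcontfun_inverse bcontfun_def)

lemma measure_le_integral:
  fixes g :: "'a::t2_space \<Rightarrow>\<^sub>C real"
  assumes M: "finite_radon_measure M" and "C \<in> sets borel" "\<And>x. indicator C x \<le> apply_bcontfun g x"
  shows "measure M C \<le> (LINT x|M. apply_bcontfun g x)"
proof -
  interpret finite_measure M using M by (rule finite_radon_measureD)
  note [simp] = finite_radon_measureD[OF M]
  have "(LINT x|M. indicator C x) \<le> (LINT x|M. apply_bcontfun g x)"
    using assms by (intro integral_mono integrable_bcontfun) (auto simp: emeasure_eq_measure)
  then show ?thesis using assms(2) by simp
qed

lemma integral_le_measure:
  fixes g :: "'a::t2_space \<Rightarrow>\<^sub>C real"
  assumes M: "finite_radon_measure M" and "U \<in> sets borel" "\<And>x. apply_bcontfun g x \<le> indicator U x"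
  shows "(LINT x|M. apply_bcontfun g x) \<le> measure M U"
proof -
  interpret finite_measure M using M by (rule finite_radon_measureD)
  note [simp] = finite_radon_measureD[OF M]
  have "(LINT x|M. apply_bcontfun g x) \<le> (LINT x|M. indicator U x)"
    using assms by (intro integral_mono integrable_bcontfun) (auto simp: emeasure_eq_measure)
  then show ?thesis using assms(2) by simp
qed

text \<open>
  Two measures stand on each side because equality of the signed measures \<open>P - N\<close> and \<open>P' - N'\<close> is
  equality of the sums \<open>P + N'\<close> and \<open>P' + N\<close>. Choose \<open>C\<close> compact inside \<open>B\<close>, almost exhausting
  it for the measures on the left, and \<open>U\<close> open around \<open>C\<close>, hardly larger for the measures on the
  right; a Urysohn function between \<open>C\<close> and \<open>U\<close> then transfers the inequality of integrals.
\<close>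

lemma measure_sum_le_of_integral_le:
  fixes P Q P' Q' :: "'a::t2_space measure"
  assumes K: "compact (UNIV :: 'a set)"
    and R: "finite_radon_measure P" "finite_radon_measure Q"
      "finite_radon_measure P'" "finite_radon_measure Q'"
    and le: "\<And>g :: 'a \<Rightarrow>\<^sub>C real. (LINT x|P. apply_bcontfun g x) + (LINT x|Q. apply_bcontfun g x)
      \<le> (LINT x|P'. apply_bcontfun g x) + (LINT x|Q'. apply_bcontfun g x)"
    and B: "B \<in> sets borel"
  shows "measure P B + measure Q B \<le> measure P' B + measure Q' B"
proof (rule field_le_epsilon)
  fix e :: real assume e: "0 < e"
  obtain C where C: "compact C" "C \<subseteq> B"
    "measure P B \<le> measure P C + e / 4" "measure Q B \<le> measure Q C + e / 4"
    using finite_radon_inner_simultaneous[of "{P, Q}" B "e / 4"] R B e by auto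
  have C': "closed C" using C(1) by (rule compact_imp_closed)
  obtain U where U: "open U" "C \<subseteq> U"
    "measure P' U \<le> measure P' C + e / 4" "measure Q' U \<le> measure Q' C + e / 4"
    using finite_radon_outer_simultaneous[of "{P', Q'}" C "e / 4"] R C' e by auto
  obtain f where f: "f \<in> below U" "\<And>x. indicator C x \<le> f x"
    using Urysohn_indicator[OF K C' U(1,2)] by blast
  define g where "g = Bcontfun f"
  have g: "apply_bcontfun g = f"
    unfolding g_def using K belowD(1)[OF f(1)] by (rule apply_Bcontfun)
  have lo: "measure M C \<le> (LINT x|M. apply_bcontfun g x)" if "finite_radon_measure M" for M
    using measure_le_integral[OF that, of C g] C' f(2) by (simp add: g)
  have up: "(LINT x|M. apply_bcontfun g x) \<le> measure M U" if "finite_radon_measure M" for M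
    using integral_le_measure[OF that, of U g] U(1) belowD(4)[OF f(1)] by (simp add: g)
  have mono: "measure M C \<le> measure M B" if M: "finite_radon_measure M" for M
  proof -
    interpret finite_measure M using M by (rule finite_radon_measureD)
    show ?thesis using C(2) B C' by (intro finite_measure_mono) (auto simp: finite_radon_measureD[OF M])
  qed
  show "measure P B + measure Q B \<le> measure P' B + measure Q' B + e"
    using C(3,4) U(3,4) lo[OF R(1)] lo[OF R(2)] up[OF R(3)] up[OF R(4)] mono[OF R(3)] mono[OF R(4)] le[of g]
    by linarith
qed

lemma signed_radon_measure_unique:
  fixes \<mu> \<nu> :: "'a::t2_space set \<Rightarrow> real"
  assumes K: "compact (UNIV :: 'a set)"
    and \<mu>: "\<mu> \<in> signed_radon_measures" and \<nu>: "\<nu> \<in> signed_radon_measures"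
    and eq: "\<And>g. signed_integral \<mu> g = signed_integral \<nu> g"
  shows "\<mu> = \<nu>"
proof -
  obtain P N where P: "finite_radon_measure P" "finite_radon_measure N"
    and PN: "\<mu> = (\<lambda>A. measure P A - measure N A)"
    using \<mu> by (auto simp: signed_radon_measures_def)
  obtain P' N' where P': "finite_radon_measure P'" "finite_radon_measure N'"
    and PN': "\<nu> = (\<lambda>A. measure P' A - measure N' A)"
    using \<nu> by (auto simp: signed_radon_measures_def)
  have int: "(LINT x|P. apply_bcontfun g x) + (LINT x|N'. apply_bcontfun g x)
      = (LINT x|P'. apply_bcontfun g x) + (LINT x|N. apply_bcontfun g x)" for g :: "'a \<Rightarrow>\<^sub>C real"
    using eq[of g] by (simp add: PN PN' signed_integral_eq P P')
  have "measure P A + measure N' A = measure P' A + measure N A" for A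
  proof (cases "A \<in> sets borel")
    case True
    show ?thesis
      using measure_sum_le_of_integral_le[OF K P(1) P'(2) P'(1) P(2) eq_refl[OF int] True]
        measure_sum_le_of_integral_le[OF K P'(1) P(2) P(1) P'(2) eq_refl[OF int[symmetric]] True]
      by simp
  next
    case False
    then show ?thesis
      \<comment> \<open>Off the Borel sets all four values are \<open>0\<close> by convention.\<close>
      using P P' by (simp add: measure_notin_sets finite_radon_measureD)
  qed
  then show ?thesis
    unfolding PN PN' by (simp add: fun_eq_iff algebra_simps)
qed

section \<open>The measures representing a positive operator\<close>

text \<open>
  The representation theorem in terms of bounded continuous functions, which on a compact space are
  all the continuous functions.
\<close>

lemma Riesz_representation:
  fixes I :: "('a::t2_space \<Rightarrow>\<^sub>C real) \<Rightarrow> real"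
  assumes K: "compact (UNIV :: 'a set)" and "linear I"
    and pos: "\<And>g. (\<And>x. 0 \<le> apply_bcontfun g x) \<Longrightarrow> 0 \<le> I g"
  shows "\<exists>P. finite_radon_measure P \<and> (\<forall>g. (LINT x|P. apply_bcontfun g x) = I g)"
proof -
  interpret linear I by fact
  note [simp] = apply_Bcontfun[OF K]
  interpret J: positive_functional "\<lambda>f. I (Bcontfun f)"
  proof
    show "compact (UNIV :: 'a set)" by fact
  next
    fix f g :: "'a \<Rightarrow> real" assume fg: "continuous_on UNIV f" "continuous_on UNIV g"
    have "Bcontfun (\<lambda>x. f x + g x) = Bcontfun f + Bcontfun g"
      using fg by (intro bcontfun_eqI) (simp add: continuous_on_add)
    then show "I (Bcontfun (\<lambda>x. f x + g x)) = I (Bcontfun f) + I (Bcontfun g)"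
      by (simp add: add)
  next
    fix f :: "'a \<Rightarrow> real" and c assume f: "continuous_on UNIV f"
    have "Bcontfun (\<lambda>x. c * f x) = c *\<^sub>R Bcontfun f"
      using f by (intro bcontfun_eqI) (simp add: continuous_on_mult_left)
    then show "I (Bcontfun (\<lambda>x. c * f x)) = c * I (Bcontfun f)"
      by (simp add: scale)
  next
    fix f :: "'a \<Rightarrow> real" assume "continuous_on UNIV f" "\<And>x. 0 \<le> f x"
    then show "0 \<le> I (Bcontfun f)" by (intro pos) simp
  qed
  have "(LINT x|J.riesz_measure. apply_bcontfun g x) = I g" for g
    using J.integral_riesz_measure[of "apply_bcontfun g"] by (simp add: apply_bcontfun_inverse)
  with J.finite_radon_riesz_measure show ?thesis by blast
qed

lemma conjugate_operator_dirac:
  fixes T :: "('k::t2_space \<Rightarrow>\<^sub>C real) \<Rightarrow> ('l::t2_space \<Rightarrow>\<^sub>C real)"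
  assumes K: "compact (UNIV :: 'k set)" and lin: "linear T" and pos: "positive_operator T"
  shows "\<exists>P. finite_radon_measure P \<and> (\<forall>g. (LINT x|P. apply_bcontfun g x) = apply_bcontfun (T g) y)
    \<and> conjugate_operator T (dirac y) = measure P"
proof -
  interpret linear T by fact
  have "linear (\<lambda>g. apply_bcontfun (T g) y)"
    by (intro linearI) (simp_all add: add scale)
  moreover have "0 \<le> apply_bcontfun (T g) y" if "\<And>x. 0 \<le> apply_bcontfun g x" for g
    using pos that by (simp add: positive_operator_def)
  ultimately obtain P where P: "finite_radon_measure P"
    and int: "\<And>g. (LINT x|P. apply_bcontfun g x) = apply_bcontfun (T g) y"
    using Riesz_representation[OF K, of "\<lambda>g. apply_bcontfun (T g) y"] by blast
  \<comment> \<open>Signed measures are differences, so the positive measure \<open>P\<close> is written as \<open>P - 0\<close>.\<close>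
  let ?N = "null_measure (borel :: 'k measure)"
  have N: "finite_radon_measure ?N" by (rule finite_radon_measure_null)
  have PN: "measure P = (\<lambda>A. measure P A - measure ?N A)"
    by (simp add: measure_def fun_eq_iff)
  have \<nu>: "measure P \<in> signed_radon_measures"
    unfolding signed_radon_measures_def using P N PN by blast
  have \<nu>_int: "signed_integral (measure P) g = signed_integral (dirac y) (T g)" for g
    using signed_integral_eq[OF P N, folded PN, of g] by (simp add: signed_integral_dirac int)
  have "conjugate_operator T (dirac y) = measure P"
    unfolding conjugate_operator_def
    using \<nu> \<nu>_int by (intro the_equality signed_radon_measure_unique[OF K]) auto
  with P int show ?thesis by blast
qed

text \<open>
  The inequality is homogeneous in \<open>g\<close> and not strict, so that for a family of functionals depending
  continuously on a parameter it becomes a closed condition.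
\<close>

lemma atom_ge_iff:
  fixes P :: "'a::t2_space measure"
  assumes K: "compact (UNIV :: 'a set)" and P: "finite_radon_measure P" and r: "0 \<le> r"
  shows "r \<le> measure P {x} \<longleftrightarrow>
    (\<forall>g. (\<forall>z. 0 \<le> apply_bcontfun g z) \<longrightarrow> r * apply_bcontfun g x \<le> (LINT z|P. apply_bcontfun g z))"
proof
  interpret finite_measure P using P by (rule finite_radon_measureD)
  note [simp] = finite_radon_measureD[OF P]
  assume le: "r \<le> measure P {x}"
  show "\<forall>g. (\<forall>z. 0 \<le> apply_bcontfun g z) \<longrightarrow> r * apply_bcontfun g x \<le> (LINT z|P. apply_bcontfun g z)"
  proof (intro allI impI)
    fix g :: "'a \<Rightarrow>\<^sub>C real" assume g: "\<forall>z. 0 \<le> apply_bcontfun g z"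
    have "r * apply_bcontfun g x \<le> measure P {x} * apply_bcontfun g x"
      using le g by (intro mult_right_mono) auto
    also have "\<dots> = (LINT z|P. indicator {x} z * apply_bcontfun g x)"
      by simp
    also have "\<dots> \<le> (LINT z|P. apply_bcontfun g z)"
      using g P by (intro integral_mono integrable_bcontfun integrable_mult_left integrable_real_indicator)
        (auto simp: emeasure_eq_measure indicator_def)
    finally show "r * apply_bcontfun g x \<le> (LINT z|P. apply_bcontfun g z)" .
  qed
next
  assume all: "\<forall>g. (\<forall>z. 0 \<le> apply_bcontfun g z) \<longrightarrow> r * apply_bcontfun g x \<le> (LINT z|P. apply_bcontfun g z)"
  show "r \<le> measure P {x}"
  proof (rule field_le_epsilon)
    fix e :: real assume e: "0 < e"
    obtain U where U: "open U" "{x} \<subseteq> U" "measure P U \<le> measure P {x} + e"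
      using finite_radon_outer[OF P _ e, of "{x}"] by auto
    obtain f where f: "f \<in> below U" "\<And>z. indicator {x} z \<le> f z"
      using Urysohn_indicator[OF K closed_singleton U(1,2)] by blast
    define g where "g = Bcontfun f"
    have g: "apply_bcontfun g = f"
      unfolding g_def using K belowD(1)[OF f(1)] by (rule apply_Bcontfun)
    have "r * 1 \<le> r * f x" using r f(2)[of x] by (intro mult_left_mono) auto
    also have "\<dots> \<le> (LINT z|P. f z)"
      using all[rule_format, of g] belowD(2)[OF f(1)] by (simp add: g)
    also have "\<dots> \<le> measure P U"
      using integral_le_measure[OF P, of U g] U(1) belowD(4)[OF f(1)] by (simp add: g)
    finally show "r \<le> measure P {x} + e" using U(3) by simp
  qed
qed

lemma mem_phi_iff:
  fixes T :: "('k::t2_space \<Rightarrow>\<^sub>C real) \<Rightarrow> ('l::t2_space \<Rightarrow>\<^sub>C real)"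
  assumes K: "compact (UNIV :: 'k set)" and lin: "linear T" and pos: "positive_operator T" and r: "0 \<le> r"
  shows "x \<in> phi T r y \<longleftrightarrow>
    (\<forall>g. (\<forall>z. 0 \<le> apply_bcontfun g z) \<longrightarrow> r * apply_bcontfun g x \<le> apply_bcontfun (T g) y)"
  using conjugate_operator_dirac[OF K lin pos, of y] atom_ge_iff[OF K _ r]
  by (auto simp: phi_def)

section \<open>Size, closed graph and surjectivity\<close>

lemma card_atoms_le:
  assumes P: "finite_radon_measure P" and total: "measure P UNIV = 1" and r: "0 < r"
  shows "finite {x. r \<le> measure P {x}} \<and> card {x. r \<le> measure P {x}} \<le> nat \<lfloor>1 / r\<rfloor>"
proof (rule finite_if_finite_subsets_card_bdd)
  interpret finite_measure P using P by (rule finite_radon_measureD)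
  note [simp] = finite_radon_measureD[OF P]
  fix F assume F: "F \<subseteq> {x. r \<le> measure P {x}}" "finite F"
  have "real (card F) * r = (\<Sum>x\<in>F. r)" by simp
  also have "\<dots> \<le> (\<Sum>x\<in>F. measure P {x})" using F(1) by (intro sum_mono) auto
  also have "\<dots> = measure P F"
    using F(2) by (intro finite_measure_eq_sum_singleton[symmetric]) auto
  also have "\<dots> \<le> 1"
    unfolding total[symmetric] by (intro finite_measure_mono) auto
  finally have "real (card F) \<le> 1 / r" using r by (simp add: field_simps)
  then show "card F \<le> nat \<lfloor>1 / r\<rfloor>" by (simp add: le_nat_floor)
qed

lemma closed_graph_phi:
  fixes T :: "('k::t2_space \<Rightarrow>\<^sub>C real) \<Rightarrow> ('l::t2_space \<Rightarrow>\<^sub>C real)"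
  assumes K: "compact (UNIV :: 'k set)" and lin: "linear T" and pos: "positive_operator T" and r: "0 \<le> r"
  shows "closed {(x, y). x \<in> phi T r y}"
proof -
  have "{(x, y). x \<in> phi T r y} =
    (\<Inter>g\<in>{g. \<forall>z. 0 \<le> apply_bcontfun g z}. {p. r * apply_bcontfun g (fst p) \<le> apply_bcontfun (T g) (snd p)})"
    by (auto simp: mem_phi_iff[OF assms])
  moreover have "continuous_on UNIV (\<lambda>p. apply_bcontfun h (fst p))"
    for h :: "'k \<Rightarrow>\<^sub>C real" by (rule continuous_on_compose2[of UNIV "apply_bcontfun h" UNIV fst]) (auto intro: continuous_intros)
  moreover have "continuous_on UNIV (\<lambda>p. apply_bcontfun h (snd p))"
    for h :: "'l \<Rightarrow>\<^sub>C real" by (rule continuous_on_compose2[of UNIV "apply_bcontfun h" UNIV snd]) (auto intro: continuous_intros)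
  ultimately show ?thesis
    by (auto intro!: closed_INT closed_Collect_le continuous_on_mult_left)
qed

text \<open>
  The function \<open>h\<close> is the pointwise minimum of \<open>1\<close> and of the quotients \<open>g / g x\<close>; members of \<open>F\<close>
  vanishing at \<open>x\<close> impose nothing and are skipped. It makes the family of sets in \<open>phi_onto\<close>
  satisfy the finite intersection property.
\<close>

lemma common_minorant:
  fixes x :: "'k::t2_space"
  assumes K: "compact (UNIV :: 'k set)" and "finite F" "\<And>g z. g \<in> F \<Longrightarrow> 0 \<le> apply_bcontfun g z"
  shows "\<exists>h :: 'k \<Rightarrow>\<^sub>C real. (\<forall>z. 0 \<le> apply_bcontfun h z) \<and> apply_bcontfun h x = 1 \<and>
    (\<forall>g\<in>F. \<forall>z. apply_bcontfun g x * apply_bcontfun h z \<le> apply_bcontfun g z)"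
  using assms(2,3)
proof (induction F rule: finite_induct)
  case empty
  then show ?case by (intro exI[of _ "const_bcontfun 1"]) simp
next
  case (insert g F)
  have "\<exists>h :: 'k \<Rightarrow>\<^sub>C real. (\<forall>z. 0 \<le> apply_bcontfun h z) \<and> apply_bcontfun h x = 1 \<and>
    (\<forall>g\<in>F. \<forall>z. apply_bcontfun g x * apply_bcontfun h z \<le> apply_bcontfun g z)"
    using insert.prems by (intro insert.IH) blast
  then obtain h where h: "\<And>z. 0 \<le> apply_bcontfun h z" "apply_bcontfun h x = 1"
    "\<And>g z. g \<in> F \<Longrightarrow> apply_bcontfun g x * apply_bcontfun h z \<le> apply_bcontfun g z"
    by blast
  have F0: "0 \<le> apply_bcontfun g' z" if "g' \<in> insert g F" for g' z
    using insert.prems that by blast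
  show ?case
  proof (cases "apply_bcontfun g x = 0")
    case True
    with h F0 show ?thesis by (intro exI[of _ h]) auto
  next
    case False
    then have gx: "0 < apply_bcontfun g x" using F0[of g x] by simp
    define k where "k = Bcontfun (\<lambda>z. min (apply_bcontfun h z) (apply_bcontfun g z / apply_bcontfun g x))"
    have k: "apply_bcontfun k = (\<lambda>z. min (apply_bcontfun h z) (apply_bcontfun g z / apply_bcontfun g x))"
      unfolding k_def using gx by (intro apply_Bcontfun[OF K] continuous_intros) auto
    have "apply_bcontfun g' x * apply_bcontfun k z \<le> apply_bcontfun g' z" if "g' \<in> insert g F" for g' z
    proof (cases "g' = g")
      case True
      have "apply_bcontfun g x * apply_bcontfun k z \<le> apply_bcontfun g x * (apply_bcontfun g z / apply_bcontfun g x)"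
        using gx by (intro mult_left_mono) (auto simp: k)
      with True gx show ?thesis by simp
    next
      case False
      have "apply_bcontfun g' x * apply_bcontfun k z \<le> apply_bcontfun g' x * apply_bcontfun h z"
        using F0[OF that] by (intro mult_left_mono) (auto simp: k)
      with False that h(3)[of g' z] show ?thesis by auto
    qed
    with h(1,2) gx F0[of g] show ?thesis
      by (intro exI[of _ k]) (auto simp: k)
  qed
qed

text \<open>
  The supremum defining \<open>inverse_norm T\<close> bounds its members only if the set is bounded above; this
  is what the lower estimate of the embedding provides.
\<close>

lemma norm_le_norm_image:
  assumes T: "isomorphic_embedding T" and m: "0 < m" and inv: "inverse_norm T = 1 / m"
  shows "m * norm g \<le> norm (T g)"
proof -
  obtain c where c: "0 < c" "\<And>g. c * norm g \<le> norm (T g)" and lin: "linear T"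
    using T by (auto simp: isomorphic_embedding_def)
  interpret linear T by fact
  have "g = h" if "T g = T h" for g h
    using c(1) c(2)[of "g - h"] that by (simp add: diff mult_le_0_iff)
  then have "inj T" by (intro injI)
  then have inv_T: "inv T (T h) = h" for h by (rule inv_f_f)
  have "norm h / norm (T h) \<le> 1 / c" for h
  proof (cases "T h = 0")
    case False
    then show ?thesis using c(1) c(2)[of h] by (simp add: field_simps)
  qed (use c in simp)
  then have "bdd_above ((\<lambda>z. norm (inv T z) / norm z) ` range T)"
    by (intro bdd_aboveI[of _ "1 / c"]) (auto simp: inv_T)
  then have "norm (inv T (T g)) / norm (T g) \<le> inverse_norm T"
    unfolding inverse_norm_def onorm_on_def
    by (intro cSUP_upper[where f = "\<lambda>z. norm (inv T z) / norm z"] rangeI)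
  then have "norm g / norm (T g) \<le> 1 / m" using inv by (simp add: inv_T)
  show ?thesis
  proof (cases "T g = 0")
    case True
    then have "norm g = 0" using c(1) c(2)[of g] by (simp add: mult_le_0_iff)
    then show ?thesis by simp
  next
    case False
    with \<open>norm g / norm (T g) \<le> 1 / m\<close> m show ?thesis by (simp add: field_simps)
  qed
qed

lemma norm_attained:
  fixes g :: "'l::topological_space \<Rightarrow>\<^sub>C real"
  assumes L: "compact (UNIV :: 'l set)"
  shows "\<exists>y. norm g = \<bar>apply_bcontfun g y\<bar>"
proof -
  obtain y where "\<And>z. \<bar>apply_bcontfun g z\<bar> \<le> \<bar>apply_bcontfun g y\<bar>"
    using continuous_attains_sup[OF L, of "\<lambda>z. \<bar>apply_bcontfun g z\<bar>"]
    by (auto intro: continuous_on_rabs)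
  then have "norm g \<le> \<bar>apply_bcontfun g y\<bar>" by (intro norm_bound) simp
  then show ?thesis using norm_bounded[of g y] by (intro exI[of _ y]) simp
qed

lemma phi_onto:
  fixes T :: "('k::t2_space \<Rightarrow>\<^sub>C real) \<Rightarrow> ('l::t2_space \<Rightarrow>\<^sub>C real)"
  assumes K: "compact (UNIV :: 'k set)" and L: "compact (UNIV :: 'l set)"
    and lin: "linear T" and pos: "positive_operator T" and m: "0 \<le> m"
    and below: "\<And>g. m * norm g \<le> norm (T g)"
  shows "\<exists>y. x \<in> phi T m y"
proof -
  interpret linear T by fact
  have mono: "apply_bcontfun (T g) y \<le> apply_bcontfun (T h) y"
    if "\<And>z. apply_bcontfun g z \<le> apply_bcontfun h z" for g h y
    using pos[unfolded positive_operator_def, rule_format, of "h - g" y] that by (simp add: diff)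
  define A where "A g = {y. m * apply_bcontfun g x \<le> apply_bcontfun (T g) y}" for g
  have "UNIV \<inter> (\<Inter>g\<in>{g. \<forall>z. 0 \<le> apply_bcontfun g z}. A g) \<noteq> {}"
  proof (rule compact_imp_fip_image[OF L])
    fix g show "closed (A g)"
      unfolding A_def by (intro closed_Collect_le continuous_on_const continuous_on_apply_bcontfun)
  next
    fix F :: "('k \<Rightarrow>\<^sub>C real) set" assume F: "finite F" "F \<subseteq> {g. \<forall>z. 0 \<le> apply_bcontfun g z}"
    then have F0: "\<And>g z. g \<in> F \<Longrightarrow> 0 \<le> apply_bcontfun g z" by auto
    obtain h where h: "\<And>z. 0 \<le> apply_bcontfun h z" "apply_bcontfun h x = 1"
      "\<And>g z. g \<in> F \<Longrightarrow> apply_bcontfun g x * apply_bcontfun h z \<le> apply_bcontfun g z"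
      using common_minorant[OF K F(1) F0] by blast
    obtain y where y: "norm (T h) = \<bar>apply_bcontfun (T h) y\<bar>"
      using norm_attained[OF L] by blast
    have "0 \<le> apply_bcontfun (T h) y" using pos h(1) by (simp add: positive_operator_def)
    moreover have "m * 1 \<le> m * norm h"
      using m norm_bounded[of h x] h(2) by (intro mult_left_mono) auto
    ultimately have my: "m \<le> apply_bcontfun (T h) y" using below[of h] y by simp
    have "y \<in> A g" if g: "g \<in> F" for g
    proof -
      have "m * apply_bcontfun g x \<le> apply_bcontfun (T h) y * apply_bcontfun g x"
        using my F0[OF g] by (rule mult_right_mono)
      also have "\<dots> = apply_bcontfun (T (apply_bcontfun g x *\<^sub>R h)) y"
        by (simp add: scale)
      also have "\<dots> \<le> apply_bcontfun (T g) y" using h(3)[OF g] by (intro mono) simp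
      finally show ?thesis by (simp add: A_def)
    qed
    then show "UNIV \<inter> (\<Inter>g\<in>F. A g) \<noteq> {}" by auto
  qed
  then show ?thesis
    unfolding mem_phi_iff[OF K lin pos m] A_def by auto
qed

theorem proposition4p2:
  fixes T :: "('k::t2_space \<Rightarrow>\<^sub>C real) \<Rightarrow> ('l::t2_space \<Rightarrow>\<^sub>C real)"
    and m :: real
  assumes "compact (UNIV :: 'k set)"
    and "compact (UNIV :: 'l set)"
    and "isomorphic_embedding T"
    and "positive_operator T"
    and "T (const_bcontfun 1) = const_bcontfun 1"
    and "m > 0"
    and "inverse_norm T = 1 / m"
  shows "(\<forall>r\<in>{0<..1}.
            (\<forall>y. phi T r y \<in> subsets_upto (nat \<lfloor>1 / r\<rfloor>)) \<and>
            upper_semicontinuous (phi T r) \<and>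
            closed (\<Union>y. phi T r y)) \<and>
         (\<Union>y. phi T m y) = UNIV"
proof (intro conjI ballI allI)
  have lin: "linear T" using assms(3) by (simp add: isomorphic_embedding_def)
  note KT = assms(1) lin assms(4)
  show "(\<Union>y. phi T m y) = UNIV"
    using phi_onto[OF assms(1,2) lin assms(4) _ norm_le_norm_image[OF assms(3,6,7)]] assms(6) by force
  fix r :: real assume "r \<in> {0<..1}"
  then have r: "0 < r" by simp
  have G: "closed {(x, y). x \<in> phi T r y}" using closed_graph_phi[OF KT] r by simp
  have proj: "compact ({(x, y). x \<in> phi T r y} \<inter> S \<times> UNIV)" if "closed S" for S
    using compact_Int_closed[OF compact_Times[OF assms(1,2)] closed_Int[OF G closed_Times[OF that closed_UNIV]]]
    by simp
  show "closed (\<Union>y. phi T r y)"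
  proof -
    have "(\<Union>y. phi T r y) = fst ` ({(x, y). x \<in> phi T r y} \<inter> UNIV \<times> UNIV)" by force
    then show ?thesis
      using compact_continuous_image[OF continuous_on_fst[OF continuous_on_id] proj[OF closed_UNIV]]
      by (simp add: compact_imp_closed)
  qed
  show "upper_semicontinuous (phi T r)"
    unfolding upper_semicontinuous_def
  proof (intro allI impI)
    fix U :: "'k set" assume "open U"
    then have "compact ({(x, y). x \<in> phi T r y} \<inter> (- U) \<times> UNIV)"
      by (intro proj closed_Compl)
    from compact_imp_closed[OF compact_continuous_image[OF continuous_on_snd[OF continuous_on_id] this]]
    have "closed (snd ` ({(x, y). x \<in> phi T r y} \<inter> (- U) \<times> UNIV))" .
    moreover have "{y. phi T r y \<subseteq> U} = - snd ` ({(x, y). x \<in> phi T r y} \<inter> (- U) \<times> UNIV)"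
      by force
    ultimately show "open {y. phi T r y \<subseteq> U}" by (simp add: open_Compl)
  qed
  fix y
  obtain P where P: "finite_radon_measure P" "conjugate_operator T (dirac y) = measure P"
    and int: "\<And>g. (LINT x|P. apply_bcontfun g x) = apply_bcontfun (T g) y"
    using conjugate_operator_dirac[OF KT, of y] by blast
  interpret finite_measure P using P(1) by (rule finite_radon_measureD)
  have "measure P UNIV = 1"
    using int[of "const_bcontfun 1"] assms(5) by (simp add: finite_radon_measureD[OF P(1)])
  from card_atoms_le[OF P(1) this r] show "phi T r y \<in> subsets_upto (nat \<lfloor>1 / r\<rfloor>)"
    by (simp add: subsets_upto_def phi_def P(2))
qed

end
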